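(* Let $\rho,\sigma$ be density operators on a complex Hilbert space of finite dimension $n$, with eigenvalue vectors $\mathbf{p}=(p_1,\dots,p_n)$ and $\mathbf{q}=(q_1,\dots,q_n)$ (counted with multiplicity). Then $$\widetilde{\mathcal{L}}_D([\rho],[\sigma]):=\min_{U\text{ unitary}}\mathcal{L}_D(U\rho U^\dagger,\sigma)=\arccos\left(\sum_{i=1}^n\sqrt{p_i^\uparrow q_i^\uparrow}\right).$$
   Context: For $\mathbf{x}\in\mathbb{R}^n$, $\mathbf{x}^\uparrow$ denotes the vector of its components arranged in non-descending order. The Bures angle is $\mathcal{L}_D(\rho,\sigma):=\arccos\left[\sqrt{\mathrm{Fid}(\rho,\sigma)}\right]$, where $\mathrm{Fid}(\rho,\sigma):=\left(\mathrm{Tr}\left[\sqrt{\sqrt{\rho}\,\sigma\sqrt{\rho}}\right]\right)^2$. *)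

theory Defs
  imports Complex_Main "Jordan_Normal_Form.Schur_Decomposition"
begin

text \<open>Operators on an n-dimensional complex Hilbert space are given by their matrices with
  respect to an orthonormal basis, so the adjoint is the conjugate transpose.\<close>

definition mat_trace :: "complex mat \<Rightarrow> complex" where
  "mat_trace A = (\<Sum>i<dim_row A. A $$ (i, i))"

definition unitary_mat :: "nat \<Rightarrow> complex mat \<Rightarrow> bool" where
  "unitary_mat n U \<longleftrightarrow>
     U \<in> carrier_mat n n \<and> mat_adjoint U * U = 1\<^sub>m n \<and> U * mat_adjoint U = 1\<^sub>m n"

definition psd_mat :: "nat \<Rightarrow> complex mat \<Rightarrow> bool" where
  "psd_mat n A \<longleftrightarrow>
     A \<in> carrier_mat n n \<and> mat_adjoint A = A \<and>
     (\<forall>v \<in> carrier_vec n. 0 \<le> Re ((A *\<^sub>v v) \<bullet>c v))"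

definition density_mat :: "nat \<Rightarrow> complex mat \<Rightarrow> bool" where
  "density_mat n A \<longleftrightarrow> psd_mat n A \<and> mat_trace A = 1"

text \<open>Meaningful for positive semidefinite arguments only; there the square root exists and is
  unique.\<close>

definition mat_sqrt :: "complex mat \<Rightarrow> complex mat" where
  "mat_sqrt A = (THE B. psd_mat (dim_row A) B \<and> B * B = A)"

text \<open>For positive semidefinite arguments the trace below is a non-negative real number; \<open>Re\<close>
  only changes the type.\<close>

definition fidelity :: "complex mat \<Rightarrow> complex mat \<Rightarrow> real" where
  "fidelity \<rho> \<sigma> = (Re (mat_trace (mat_sqrt (mat_sqrt \<rho> * \<sigma> * mat_sqrt \<rho>))))\<^sup>2"

definition bures_angle :: "complex mat \<Rightarrow> complex mat \<Rightarrow> real" where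
  "bures_angle \<rho> \<sigma> = arccos (sqrt (fidelity \<rho> \<sigma>))"

text \<open>The distance between the unitary orbits of \<open>\<rho>\<close> and \<open>\<sigma>\<close>, written in terms of
  representatives of the two orbits.\<close>

definition min_bures_angle :: "nat \<Rightarrow> complex mat \<Rightarrow> complex mat \<Rightarrow> real" where
  "min_bures_angle n \<rho> \<sigma> =
     (LEAST x. \<exists>U. unitary_mat n U \<and> x = bures_angle (U * \<rho> * mat_adjoint U) \<sigma>)"

text \<open>\<open>p\<close> lists the eigenvalues of \<open>A\<close>, in any order, as often as their multiplicity as roots of
  the characteristic polynomial (for Hermitian \<open>A\<close>, the dimension of the eigenspace).\<close>

definition eigenvalue_vector :: "nat \<Rightarrow> complex mat \<Rightarrow> real list \<Rightarrow> bool" where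
  "eigenvalue_vector n A p \<longleftrightarrow>
     length p = n \<and> char_poly A = (\<Prod>a\<leftarrow>p. [:- complex_of_real a, 1:])"

end

theory Submission
  imports Defs
begin

text \<open>Write \<open>\<rho> = U P U\<^sup>*\<close> and \<open>\<sigma> = V Q V\<^sup>*\<close> with both spectra in non-descending order. The square root of the
  fidelity is the trace of the modulus of \<open>M = sqrt \<sigma> sqrt \<rho>\<close>, which a polar decomposition turns into
  \<open>Tr (K M)\<close> with \<open>K\<close> a partial isometry. In the eigenbases this is
  \<open>\<Sum>i j. X\<^sub>i\<^sub>j Y\<^sub>j\<^sub>i sqrt (p\<^sub>i q\<^sub>j)\<close> with partial isometries \<open>X\<close> and \<open>Y\<close>; by AM-GM the weights are dominated by
  the doubly substochastic \<open>(\<bar>X\<^sub>i\<^sub>j\<bar>\<^sup>2 + \<bar>Y\<^sub>j\<^sub>i\<bar>\<^sup>2) / 2\<close>, and a rearrangement inequality for such weights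
  bounds the sum by its diagonal value. Partial isometries suffice here, so \<open>K\<close> need not be extended
  to a unitary. The bound is attained when \<open>\<rho>\<close> is rotated to be diagonal in the eigenbasis of \<open>\<sigma>\<close> with
  equally ordered eigenvalues.\<close>

section \<open>A rearrangement inequality\<close>

lemma substochastic_bilinear_le:
  fixes d :: "nat \<Rightarrow> nat \<Rightarrow> real" and a b :: "nat \<Rightarrow> real"
  assumes d: "\<And>i j. i < n \<Longrightarrow> j < n \<Longrightarrow> 0 \<le> d i j"
    and row: "\<And>i. i < n \<Longrightarrow> (\<Sum>j<n. d i j) \<le> 1"
    and col: "\<And>j. j < n \<Longrightarrow> (\<Sum>i<n. d i j) \<le> 1"
    and a: "\<And>i. i < n \<Longrightarrow> 0 \<le> a i" "\<And>i j. i \<le> j \<Longrightarrow> j < n \<Longrightarrow> a i \<le> a j"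
    and b: "\<And>i. i < n \<Longrightarrow> 0 \<le> b i" "\<And>i j. i \<le> j \<Longrightarrow> j < n \<Longrightarrow> b i \<le> b j"
  shows "(\<Sum>i<n. \<Sum>j<n. d i j * (a i * b j)) \<le> (\<Sum>i<n. a i * b i)"
proof -
  \<comment> \<open>Layer cake: a non-negative monotone sequence is a non-negative combination of the indicators
    \<open>h k\<close> of final segments, and the claim is bilinear, so it suffices to check it on two indicators.\<close>
  define \<delta> where "\<delta> c k = (if k = 0 then c 0 else c k - c (k - 1))" for c :: "nat \<Rightarrow> real" and k
  define h :: "nat \<Rightarrow> nat \<Rightarrow> real" where "h k i = of_bool (k \<le> i)" for k i
  have telescope: "(\<Sum>k\<le>i. \<delta> c k) = c i" for c i
    by (induction i) (auto simp: \<delta>_def)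
  have layers: "c i = (\<Sum>k<n. \<delta> c k * h k i)" if "i < n" for c i
  proof -
    have "(\<Sum>k<n. \<delta> c k * h k i) = (\<Sum>k\<in>{..i}. \<delta> c k * h k i)"
      using that by (intro sum.mono_neutral_right) (auto simp: h_def)
    also have "\<dots> = (\<Sum>k\<le>i. \<delta> c k)" by (intro sum.cong) (auto simp: h_def)
    finally show ?thesis using telescope by simp
  qed
  have \<delta>_nonneg: "0 \<le> \<delta> a k" "0 \<le> \<delta> b k" if "k < n" for k
    using that a b by (auto simp: \<delta>_def)
  \<comment> \<open>The right side counts the indices from \<open>max k l\<close> on. Dropping the
    factor with the smaller threshold leaves full row sums if \<open>l \<le> k\<close> and full
    column sums otherwise, each at most 1.\<close>
  have layer: "(\<Sum>i<n. \<Sum>j<n. d i j * (h k i * h l j)) \<le> (\<Sum>i<n. h k i * h l i)" for k l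
  proof (cases "l \<le> k")
    case True
    have "(\<Sum>i<n. \<Sum>j<n. d i j * (h k i * h l j)) \<le> (\<Sum>i<n. h k i * (\<Sum>j<n. d i j))"
      unfolding sum_distrib_left by (intro sum_mono) (auto simp: h_def d)
    also have "\<dots> \<le> (\<Sum>i<n. h k i * 1)"
      by (intro sum_mono mult_left_mono row) (auto simp: h_def)
    also have "\<dots> = (\<Sum>i<n. h k i * h l i)"
      using True by (intro sum.cong) (auto simp: h_def)
    finally show ?thesis .
  next
    case False
    have "(\<Sum>i<n. \<Sum>j<n. d i j * (h k i * h l j)) = (\<Sum>j<n. \<Sum>i<n. d i j * (h k i * h l j))"
      by (rule sum.swap)
    also have "\<dots> \<le> (\<Sum>j<n. h l j * (\<Sum>i<n. d i j))"
      unfolding sum_distrib_left by (intro sum_mono) (auto simp: h_def d)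
    also have "\<dots> \<le> (\<Sum>j<n. h l j * 1)"
      by (intro sum_mono mult_left_mono col) (auto simp: h_def)
    also have "\<dots> = (\<Sum>i<n. h k i * h l i)"
      using False by (intro sum.cong) (auto simp: h_def)
    finally show ?thesis .
  qed
  \<comment> \<open>Kept general in the weights \<open>e\<close> because it is used twice: for
    \<open>d\<close>, and for the identity weights, which produce the diagonal sum.\<close>
  have expand: "(\<Sum>i<n. \<Sum>j<n. e i j * (a i * b j)) =
      (\<Sum>k<n. \<Sum>l<n. \<delta> a k * \<delta> b l * (\<Sum>i<n. \<Sum>j<n. e i j * (h k i * h l j)))"
    for e :: "nat \<Rightarrow> nat \<Rightarrow> real"
  proof -
    have "(\<Sum>i<n. \<Sum>j<n. e i j * (a i * b j)) =
        (\<Sum>i<n. \<Sum>j<n. \<Sum>k<n. \<Sum>l<n. \<delta> a k * \<delta> b l * (e i j * (h k i * h l j)))"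
      by (intro sum.cong refl, subst layers[of _ a], simp, subst layers[of _ b], simp)
        (simp only: sum_product, simp add: sum_distrib_left mult_ac)
    also have "\<dots> = (\<Sum>i<n. \<Sum>k<n. \<Sum>j<n. \<Sum>l<n. \<delta> a k * \<delta> b l * (e i j * (h k i * h l j)))"
      by (intro sum.cong refl sum.swap)
    also have "\<dots> = (\<Sum>k<n. \<Sum>i<n. \<Sum>l<n. \<Sum>j<n. \<delta> a k * \<delta> b l * (e i j * (h k i * h l j)))"
      by (subst sum.swap) (intro sum.cong refl sum.swap)
    also have "\<dots> = (\<Sum>k<n. \<Sum>l<n. \<Sum>i<n. \<Sum>j<n. \<delta> a k * \<delta> b l * (e i j * (h k i * h l j)))"
      by (intro sum.cong refl sum.swap)
    finally show ?thesis by (simp add: sum_distrib_left)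
  qed
  have diagonal: "(\<Sum>i<n. \<Sum>j<n. of_bool (i = j) * f i j) = (\<Sum>i<n. f i i)"
    for f :: "nat \<Rightarrow> nat \<Rightarrow> real"
    by (intro sum.cong refl) (simp add: if_distrib if_distribR cong: if_cong)
  have "(\<Sum>i<n. \<Sum>j<n. d i j * (a i * b j)) =
      (\<Sum>k<n. \<Sum>l<n. \<delta> a k * \<delta> b l * (\<Sum>i<n. \<Sum>j<n. d i j * (h k i * h l j)))"
    by (rule expand)
  also have "\<dots> \<le> (\<Sum>k<n. \<Sum>l<n. \<delta> a k * \<delta> b l * (\<Sum>i<n. h k i * h l i))"
    by (intro sum_mono mult_left_mono layer mult_nonneg_nonneg \<delta>_nonneg) auto
  also have "\<dots> = (\<Sum>i<n. a i * b i)"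
    using expand[of "\<lambda>i j. of_bool (i = j)"] by (simp only: diagonal)
  finally show ?thesis .
qed

section \<open>Adjoints, traces and unitary matrices\<close>

lemma mat_adjoint_dim [simp]:
  "dim_row (mat_adjoint A) = dim_col A" "dim_col (mat_adjoint A) = dim_row A"
  unfolding mat_adjoint_def by auto

lemma mat_adjoint_carrier [simp]: "A \<in> carrier_mat n m \<Longrightarrow> mat_adjoint A \<in> carrier_mat m n"
  unfolding carrier_mat_def by simp

lemma mat_adjoint_index [simp]:
  fixes A :: "complex mat"
  shows "i < dim_col A \<Longrightarrow> j < dim_row A \<Longrightarrow> mat_adjoint A $$ (i, j) = cnj (A $$ (j, i))"
  unfolding mat_adjoint_def by (simp add: mat_of_rows_index)

lemma mat_adjoint_adjoint [simp]: "mat_adjoint (mat_adjoint A) = (A :: complex mat)"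
  by (intro eq_matI) auto

lemma mat_adjoint_mult:
  fixes A B :: "complex mat"
  assumes "A \<in> carrier_mat n m" "B \<in> carrier_mat m k"
  shows "mat_adjoint (A * B) = mat_adjoint B * mat_adjoint A"
  using assms by (intro eq_matI) (auto simp: scalar_prod_def mult.commute)

lemma mat_adjoint_mat_diag [simp]:
  "mat_adjoint (mat_diag n f) = mat_diag n (\<lambda>i. cnj (f i))"
  by (intro eq_matI) (auto simp: mat_diag_def)

lemma mat_adjoint_one [simp]: "mat_adjoint (1\<^sub>m n) = (1\<^sub>m n :: complex mat)"
  by (intro eq_matI) auto

lemma mat_diag_cong:
  "(\<And>i. i < n \<Longrightarrow> f i = g i) \<Longrightarrow> mat_diag n f = mat_diag n g"
  by (intro eq_matI) (auto simp: mat_diag_def)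

lemma mat_trace_comm:
  assumes "A \<in> carrier_mat n m" "B \<in> carrier_mat m n"
  shows "mat_trace (A * B) = mat_trace (B * A)"
proof -
  have "mat_trace (A * B) = (\<Sum>i<n. \<Sum>j<m. A $$ (i, j) * B $$ (j, i))"
    using assms by (auto simp: mat_trace_def scalar_prod_def atLeast0LessThan)
  also have "\<dots> = (\<Sum>j<m. \<Sum>i<n. B $$ (j, i) * A $$ (i, j))"
    by (subst sum.swap) (simp add: mult.commute)
  also have "\<dots> = mat_trace (B * A)"
    using assms by (auto simp: mat_trace_def scalar_prod_def atLeast0LessThan)
  finally show ?thesis .
qed

lemma mat_trace_mat_diag [simp]: "mat_trace (mat_diag n f) = (\<Sum>i<n. f i)"
  by (simp add: mat_trace_def mat_diag_def)

lemma mult_mat_vec_cscalar_prod: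
  fixes A :: "complex mat"
  assumes "A \<in> carrier_mat n m" "v \<in> carrier_vec m" "w \<in> carrier_vec n"
  shows "(A *\<^sub>v v) \<bullet>c w = v \<bullet>c (mat_adjoint A *\<^sub>v w)"
proof -
  have "(A *\<^sub>v v) \<bullet>c w = (\<Sum>i<n. \<Sum>j<m. A $$ (i, j) * v $ j * cnj (w $ i))"
    using assms by (auto simp: scalar_prod_def atLeast0LessThan sum_distrib_right intro!: sum.cong)
  also have "\<dots> = (\<Sum>j<m. \<Sum>i<n. v $ j * cnj (mat_adjoint A $$ (j, i) * w $ i))"
    using assms by (subst sum.swap) (auto intro!: sum.cong simp: mult_ac)
  also have "\<dots> = v \<bullet>c (mat_adjoint A *\<^sub>v w)"
    using assms by (auto simp: scalar_prod_def atLeast0LessThan sum_distrib_left intro!: sum.cong)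
  finally show ?thesis .
qed

lemma unitary_matD:
  assumes "unitary_mat n U"
  shows "U \<in> carrier_mat n n" "mat_adjoint U * U = 1\<^sub>m n" "U * mat_adjoint U = 1\<^sub>m n"
  using assms unfolding unitary_mat_def by auto

lemma unitary_mat_adjoint: "unitary_mat n U \<Longrightarrow> unitary_mat n (mat_adjoint U)"
  unfolding unitary_mat_def by auto

text \<open>For square matrices a left inverse is also a right inverse.\<close>

lemma unitary_matI:
  assumes "U \<in> carrier_mat n n" "mat_adjoint U * U = 1\<^sub>m n"
  shows "unitary_mat n U"
  using assms mat_mult_left_right_inverse[of "mat_adjoint U" n U] unfolding unitary_mat_def by auto

text \<open>Right-nested because \<open>assoc_mult_mat\<close> is used as a simp rule.\<close>

lemma unitary_mat_cancel:
  assumes "unitary_mat n U" "X \<in> carrier_mat n n"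
  shows "mat_adjoint U * (U * X) = X" "U * (mat_adjoint U * X) = X"
  using unitary_matD[OF assms(1)] assms(2)
  by (simp_all flip: assoc_mult_mat[of "mat_adjoint U" n n U n X n] assoc_mult_mat[of U n n "mat_adjoint U" n X n])

lemma unitary_mat_mult:
  assumes "unitary_mat n U" "unitary_mat n V"
  shows "unitary_mat n (U * V)"
proof -
  note U = unitary_matD[OF assms(1)] and V = unitary_matD[OF assms(2)]
  note [simp] = assoc_mult_mat[of _ n n _ n _ n] unitary_mat_cancel[OF assms(1)] 
    unitary_mat_cancel[OF assms(2)]
  show ?thesis using U V by (intro unitary_matI) (simp_all add: mat_adjoint_mult[of _ n n _ n])
qed

section \<open>Unitary diagonalization\<close>

text \<open>Complete \<open>v\<close> to a basis, orthogonalize by Gram-Schmidt, which keeps the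
  first vector, and normalize the columns. The factor \<open>c\<close> is there because
  \<open>v\<close> need not have norm 1.\<close>

lemma ex_unitary_mat_first_col:
  assumes v: "v \<in> carrier_vec n" and v0: "v \<noteq> 0\<^sub>v n"
  shows "\<exists>U c. unitary_mat n U \<and> col U 0 = c \<cdot>\<^sub>v v"
proof -
  interpret cof_vec_space n "TYPE(complex)" .
  define ws where "ws = gram_schmidt n (basis_completion v)"
  note b = basis_completion[OF v v0]
  from v v0 have n: "n \<noteq> 0" by (metis eq_vecI carrier_vecD index_zero_vec(2) less_zeroE)
  with b(6) have "basis_completion v \<noteq> []" by auto
  with b(7) obtain vs where bv: "basis_completion v = v # vs" by (cases "basis_completion v") auto
  have ws: "set ws \<subseteq> carrier_vec n" "corthogonal ws" "length ws = n" "hd ws = v"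
    using gram_schmidt_result[OF b(2,4,5) refl] gram_schmidt_hd[OF v, of vs] b(6) bv
    unfolding ws_def by auto
  have wsi: "ws ! i \<in> carrier_vec n" if "i < n" for i
    using ws that by (auto intro: nth_mem)
  \<comment> \<open>\<open>s i\<close> is the squared norm of the \<open>i\<close>-th orthogonal
    vector and \<open>r i\<close> the factor that normalizes it.\<close>
  define s where "s i = Re (ws ! i \<bullet>c ws ! i)" for i
  define r where "r i = complex_of_real (1 / sqrt (s i))" for i
  have s: "0 < s i" "ws ! i \<bullet>c ws ! i = complex_of_real (s i)" if "i < n" for i
  proof -
    have "ws ! i \<bullet>c ws ! i \<noteq> 0" using ws that unfolding corthogonal_def by auto
    moreover have "0 \<le> ws ! i \<bullet>c ws ! i" by (rule conjugate_square_ge_0_vec)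
    ultimately show "0 < s i" "ws ! i \<bullet>c ws ! i = complex_of_real (s i)"
      unfolding s_def by (auto simp: less_eq_complex_def complex_eq_iff)
  qed
  define U where "U = mat n n (\<lambda>(i, j). ws ! j $ i * r j)"
  have U: "U \<in> carrier_mat n n" unfolding U_def by simp
  have "mat_adjoint U * U = 1\<^sub>m n"
  proof (rule eq_matI)
    fix i j assume ij: "i < dim_row (1\<^sub>m n :: complex mat)" "j < dim_col (1\<^sub>m n :: complex mat)"
    have "(mat_adjoint U * U) $$ (i, j) = (\<Sum>k<n. cnj (ws ! i $ k * r i) * (ws ! j $ k * r j))"
      using ij by (simp add: U_def scalar_prod_def atLeast0LessThan)
    also have "\<dots> = r i * r j * (ws ! j \<bullet>c ws ! i)"
      using ij wsi[of i] wsi[of j]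
      by (auto simp: scalar_prod_def atLeast0LessThan sum_distrib_left r_def mult_ac intro!: sum.cong)
    also have "\<dots> = 1\<^sub>m n $$ (i, j)"
    proof (cases "i = j")
      case True
      have "r i * r i * complex_of_real (s i) = complex_of_real (1 / sqrt (s i) * (1 / sqrt (s i)) * s i)"
        unfolding r_def by (simp only: of_real_mult)
      also have "1 / sqrt (s i) * (1 / sqrt (s i)) * s i = 1" using s(1)[of i] ij by simp
      finally show ?thesis using True s(2)[of i] ij by simp
    next
      case False
      with ws ij have "ws ! j \<bullet>c ws ! i = 0" unfolding corthogonal_def by auto
      with False ij show ?thesis by simp
    qed
    finally show "(mat_adjoint U * U) $$ (i, j) = 1\<^sub>m n $$ (i, j)" .
  qed (auto simp: U_def)
  with U have "unitary_mat n U" by (rule unitary_matI)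
  moreover have "col U 0 = r 0 \<cdot>\<^sub>v v"
  proof -
    have "ws ! 0 = v" using ws n by (cases ws) auto
    with v n show ?thesis unfolding U_def by (intro eq_vecI) auto
  qed
  ultimately show ?thesis by blast
qed

section \<open>Block-diagonal matrices and the spectral theorem\<close>

lemma mat_diag_Cons:
  "mat_diag (Suc n) ((!) (e # es)) =
     four_block_mat (mat 1 1 (\<lambda>_. e)) (0\<^sub>m 1 n) (0\<^sub>m n 1) (mat_diag n ((!) es))"
  by (intro eq_matI) (auto simp: mat_diag_def nth_Cons')

lemma mat_adjoint_four_block_diag:
  fixes A D :: "complex mat"
  assumes "A \<in> carrier_mat k k" "D \<in> carrier_mat m m"
  shows "mat_adjoint (four_block_mat A (0\<^sub>m k m) (0\<^sub>m m k) D) =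
    four_block_mat (mat_adjoint A) (0\<^sub>m k m) (0\<^sub>m m k) (mat_adjoint D)"
  using assms by (intro eq_matI) auto

lemma mult_four_block_diag:
  fixes A D :: "complex mat"
  assumes "A \<in> carrier_mat k k" "D \<in> carrier_mat m m" "A' \<in> carrier_mat k k" "D' \<in> carrier_mat m m"
  shows "four_block_mat A (0\<^sub>m k m) (0\<^sub>m m k) D * four_block_mat A' (0\<^sub>m k m) (0\<^sub>m m k) D' =
    four_block_mat (A * A') (0\<^sub>m k m) (0\<^sub>m m k) (D * D')"
  using assms by (subst mult_four_block_mat) auto

text \<open>Deflation, by induction on the list of roots: in an orthonormal basis starting with an
  eigenvector for the first root, \<open>A\<close> splits into a 1 by 1 block and a smaller
  Hermitian block with the remaining roots. The given order of \<open>es\<close> survives, which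
  later allows a sorted spectrum.\<close>

theorem hermitian_unitary_diagonalization:
  fixes A :: "complex mat"
  assumes "A \<in> carrier_mat n n" "mat_adjoint A = A" "char_poly A = (\<Prod>e\<leftarrow>es. [:- e, 1:])"
  shows "\<exists>U. unitary_mat n U \<and> A = U * mat_diag n ((!) es) * mat_adjoint U"
  using assms
proof (induction es arbitrary: n A)
  case Nil
  \<comment> \<open>The characteristic polynomial has degree \<open>n\<close> and is here the empty
    product; the empty matrix \<open>A\<close> then serves as its own unitary.\<close>
  with degree_monic_char_poly[of A n] have n: "n = 0" by simp
  with Nil have "unitary_mat n A" "A = A * mat_diag n ((!) []) * mat_adjoint A"
    unfolding unitary_mat_def by (auto intro!: eq_matI simp: mat_diag_def)
  then show ?case by blast
next
  case (Cons e es n A)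
  note A = Cons.prems(1)
  obtain v where v: "v \<in> carrier_vec n" "v \<noteq> 0\<^sub>v n" "A *\<^sub>v v = e \<cdot>\<^sub>v v"
    using eigenvalue_root_char_poly[OF A, of e] A Cons.prems(3)
    unfolding eigenvalue_def eigenvector_def by auto
  obtain m where n: "n = Suc m"
    using v by (cases n) (auto simp: eq_vecI)
  obtain W c where W: "unitary_mat n W" and col: "col W 0 = c \<cdot>\<^sub>v v"
    using ex_unitary_mat_first_col[OF v(1,2)] by blast
  note Wc = unitary_matD[OF W]
  note [simp] = assoc_mult_mat[of _ n n _ n _ n] unitary_mat_cancel[OF W] A Wc
    mult_carrier_mat[of _ n n _ n] right_mult_one_mat[of _ n n]
    mat_adjoint_mult[of _ n n _ n] Cons.prems(2)
  define B where "B = mat_adjoint W * (A * W)"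
  have B: "B \<in> carrier_mat n n" unfolding B_def by simp
  have B_adj: "mat_adjoint B = B" unfolding B_def by simp
  have A_B: "A = W * B * mat_adjoint W" unfolding B_def by simp
  have "similar_mat B A"
    using B by (intro similar_matI[of _ _ "mat_adjoint W" W n]) (auto simp: B_def)
  from char_poly_similar[OF this]
  have char_B: "char_poly B = [:- e, 1:] * (\<Prod>e\<leftarrow>es. [:- e, 1:])"
    using Cons.prems(3) by simp
  \<comment> \<open>\<open>col W 0\<close> is a multiple of \<open>v\<close>, so \<open>A\<close>
    scales it by \<open>e\<close>; unitarity of \<open>W\<close> turns it into the first unit
    vector.\<close>
  have B_col: "B $$ (i, 0) = (if i = 0 then e else 0)" if "i < n" for i
  proof -
    have "col (A * W) 0 = A *\<^sub>v col W 0" using A Wc n by (intro col_mult2[of _ n n _ n]) auto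
    also have "\<dots> = e \<cdot>\<^sub>v col W 0"
      using v A by (auto simp: col mult_mat_vec[of _ n n] smult_smult_assoc mult.commute)
    finally have "B $$ (i, 0) = row (mat_adjoint W) i \<bullet> (e \<cdot>\<^sub>v col W 0)"
      using that n A Wc unfolding B_def by simp
    also have "\<dots> = e * (row (mat_adjoint W) i \<bullet> col W 0)"
      using that v(1) by (intro scalar_prod_smult_distrib[of _ n]) (auto simp: col)
    also have "row (mat_adjoint W) i \<bullet> col W 0 = (mat_adjoint W * W) $$ (i, 0)"
      using that n Wc(1) by (simp del: Wc(2))
    also have "\<dots> = (if i = 0 then 1 else 0)"
      unfolding Wc(2) using that n by simp
    finally show ?thesis by simp
  qed
  \<comment> \<open>Since \<open>B\<close> is Hermitian, the zeros of the first column carry over to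
    the first row.\<close>
  have B_row: "B $$ (0, i) = 0" if "0 < i" "i < n" for i
  proof -
    have "B $$ (0, i) = cnj (B $$ (i, 0))"
      using that B n by (subst B_adj[symmetric]) simp
    then show ?thesis using B_col that by simp
  qed
  define D where "D = mat m m (\<lambda>(i, j). B $$ (Suc i, Suc j))"
  let ?e = "mat 1 1 (\<lambda>_. e)"
  have D: "D \<in> carrier_mat m m" unfolding D_def by simp
  have B_block: "B = four_block_mat ?e (0\<^sub>m 1 m) (0\<^sub>m m 1) D"
    using B n B_col B_row by (intro eq_matI) (auto simp: D_def)
  have "mat_adjoint D = D"
  proof (rule eq_matI)
    fix i j assume "i < dim_row D" "j < dim_col D"
    then have ij: "i < m" "j < m" using D by auto
    have "cnj (B $$ (Suc j, Suc i)) = mat_adjoint B $$ (Suc i, Suc j)"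
      using ij B n by simp
    then show "mat_adjoint D $$ (i, j) = D $$ (i, j)"
      using ij unfolding B_adj by (simp add: D_def)
  qed (simp_all add: D_def)
  moreover have "char_poly D = (\<Prod>e\<leftarrow>es. [:- e, 1:])"
  proof -
    have "char_poly B = char_poly ?e * char_poly D"
      unfolding B_block using D by (intro char_poly_four_block_zeros_col) auto
    also have "char_poly ?e = [:- e, 1:]"
      by (simp add: char_poly_defs det_def sign_def)
    \<comment> \<open>Polynomials over a field have no zero divisors, so the linear factor for
      \<open>e\<close> cancels.\<close>
    finally show ?thesis unfolding char_B
      by (metis mult_cancel_left pCons_eq_0_iff zero_neq_one)
  qed
  ultimately obtain V where V: "unitary_mat m V" and DV: "D = V * mat_diag m ((!) es) * mat_adjoint V"
    using Cons.IH[OF D] by blast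
  note Vc = unitary_matD[OF V]
  define V' where "V' = four_block_mat (1\<^sub>m 1) (0\<^sub>m 1 m) (0\<^sub>m m 1) V"
  have V'_adj: "mat_adjoint V' = four_block_mat (1\<^sub>m 1) (0\<^sub>m 1 m) (0\<^sub>m m 1) (mat_adjoint V)"
    unfolding V'_def using Vc(1) by (simp add: mat_adjoint_four_block_diag)
  have V'_carrier: "V' \<in> carrier_mat n n" using Vc(1) n unfolding V'_def by auto
  have V': "unitary_mat n V'"
  proof (rule unitary_matI[OF V'_carrier])
    have "mat_adjoint V' * V' = four_block_mat (1\<^sub>m 1) (0\<^sub>m 1 m) (0\<^sub>m m 1) (1\<^sub>m m)"
      unfolding V'_adj unfolding V'_def using Vc by (simp add: mult_four_block_diag)
    also have "\<dots> = 1\<^sub>m n" unfolding n by (intro eq_matI) auto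
    finally show "mat_adjoint V' * V' = 1\<^sub>m n" .
  qed
  have B_diag: "B = V' * mat_diag n ((!) (e # es)) * mat_adjoint V'"
    unfolding V'_adj unfolding V'_def n mat_diag_Cons B_block DV
    using Vc(1) by (simp add: mult_four_block_diag mult_carrier_mat[of _ m m _ m])
  have "A = (W * V') * mat_diag n ((!) (e # es)) * mat_adjoint (W * V')"
    unfolding A_B B_diag using V'_carrier by simp
  with unitary_mat_mult[OF W V'] show ?case by blast
qed

section \<open>Positive semidefinite matrices\<close>

abbreviation real_diag :: "nat \<Rightarrow> (nat \<Rightarrow> real) \<Rightarrow> complex mat" where
  "real_diag n f \<equiv> mat_diag n (\<lambda>i. complex_of_real (f i))"

lemma mult_cnj_weighted:
  "complex_of_real c * z * cnj z = complex_of_real (c * (cmod z)\<^sup>2)"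
  by (simp only: of_real_mult complex_norm_square mult.assoc)

lemma mult_cnj_cmod: "z * cnj z = complex_of_real ((cmod z)\<^sup>2)"
  by (simp only: complex_norm_square)

lemma row_mat_adjoint:
  fixes A :: "complex mat"
  shows "i < dim_col A \<Longrightarrow> row (mat_adjoint A) i = conjugate (col A i)"
  by (intro eq_vecI) auto

text \<open>In the coordinates \<open>w = mat_adjoint U *\<^sub>v v\<close> the quadratic form is
  the sum of the squared moduli of the \<open>w $ i\<close> with weights \<open>f i\<close>.\<close>

lemma psd_mat_real_diag:
  assumes U: "unitary_mat n U" and f: "\<And>i. i < n \<Longrightarrow> 0 \<le> f i"
  shows "psd_mat n (U * real_diag n f * mat_adjoint U)"
  unfolding psd_mat_def
proof (intro conjI ballI)
  note Uc = unitary_matD[OF U]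
  let ?A = "U * real_diag n f * mat_adjoint U"
  show A: "?A \<in> carrier_mat n n" using Uc(1) by (auto intro!: mult_carrier_mat)
  show "mat_adjoint ?A = ?A"
    using Uc(1) by (simp add: mat_adjoint_mult[of _ n n _ n] mult_carrier_mat[of _ n n _ n]
      assoc_mult_mat[of _ n n _ n _ n])
  fix v :: "complex vec" assume v: "v \<in> carrier_vec n"
  define w where "w = mat_adjoint U *\<^sub>v v"
  have w: "w \<in> carrier_vec n" using v Uc(1) by (auto simp: w_def intro!: mult_mat_vec_carrier)
  have "?A *\<^sub>v v = U *\<^sub>v (real_diag n f *\<^sub>v w)"
    using v w Uc(1) by (simp add: w_def assoc_mult_mat_vec[of _ n n _ n] mult_carrier_mat[of _ n n _ n])
  then have "(?A *\<^sub>v v) \<bullet>c v = (real_diag n f *\<^sub>v w) \<bullet>c w"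
    using v w Uc(1) by (simp add: mult_mat_vec_cscalar_prod[of U n n] w_def
        mult_mat_vec_carrier[of _ n n])
  also have "real_diag n f *\<^sub>v w = vec n (\<lambda>i. complex_of_real (f i) * w $ i)"
    using w by (intro eq_vecI) (auto simp: mat_diag_def scalar_prod_def if_distrib if_distribR cong: if_cong)
  also have "\<dots> \<bullet>c w = complex_of_real (\<Sum>i<n. f i * (cmod (w $ i))\<^sup>2)"
    unfolding of_real_sum mult_cnj_weighted[symmetric]
    using w by (simp add: scalar_prod_def atLeast0LessThan)
  finally show "0 \<le> Re ((?A *\<^sub>v v) \<bullet>c v)"
    using f by (auto intro!: sum_nonneg)
qed

text \<open>The root \<open>es ! i\<close> is the value of the quadratic form of \<open>A\<close> at
  column \<open>i\<close> of \<open>U\<close>, so its real part is non-negative; its imaginary part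
  vanishes because the diagonal matrix is Hermitian. Taking \<open>es\<close> as given keeps control
  over the order of the eigenvalues.\<close>

lemma psd_mat_diagonalization:
  assumes A: "psd_mat n A" and es: "char_poly A = (\<Prod>e\<leftarrow>es. [:- e, 1:])"
  shows "\<exists>U. unitary_mat n U \<and> A = U * real_diag n (\<lambda>i. Re (es ! i)) * mat_adjoint U \<and>
    (\<forall>i<n. 0 \<le> Re (es ! i) \<and> Im (es ! i) = 0)"
proof -
  have Ac: "A \<in> carrier_mat n n" and herm: "mat_adjoint A = A"
    and pos: "\<And>v. v \<in> carrier_vec n \<Longrightarrow> 0 \<le> Re ((A *\<^sub>v v) \<bullet>c v)"
    using A unfolding psd_mat_def by auto
  obtain U where U: "unitary_mat n U" and AU: "A = U * mat_diag n ((!) es) * mat_adjoint U"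
    using hermitian_unitary_diagonalization[OF Ac herm es] by blast
  note Uc = unitary_matD[OF U]
  note [simp] = assoc_mult_mat[of _ n n _ n _ n] unitary_mat_cancel[OF U] Uc mult_carrier_mat[of _ n n _ n]
    right_mult_one_mat[of _ n n]
  have D: "mat_adjoint U * (A * U) = mat_diag n ((!) es)" unfolding AU by simp
  have e: "0 \<le> Re (es ! i) \<and> Im (es ! i) = 0" if i: "i < n" for i
  proof
    have ci: "col U i \<in> carrier_vec n" using Uc(1) i by auto
    have "es ! i = (mat_adjoint U * (A * U)) $$ (i, i)" unfolding D using i by (simp add: mat_diag_def)
    also have "\<dots> = conjugate (col U i) \<bullet> (A *\<^sub>v col U i)"
      using i Ac carrier_matD[OF Uc(1)] carrier_matD[OF Ac]
      by (simp add: row_mat_adjoint col_mult2[of _ n n _ n])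
    also have "\<dots> = (A *\<^sub>v col U i) \<bullet>c col U i"
      using ci Ac by (intro comm_scalar_prod[of _ n]) auto
    finally show "0 \<le> Re (es ! i)" using pos[OF ci] by simp
    have "mat_adjoint (mat_adjoint U * (A * U)) = mat_adjoint U * (A * U)"
      using Uc(1) Ac herm by (simp add: mat_adjoint_mult[of _ n n _ n])
    then have "mat_adjoint (mat_diag n ((!) es)) $$ (i, i) = mat_diag n ((!) es) $$ (i, i)"
      unfolding D by simp
    then show "Im (es ! i) = 0" using i by (simp add: mat_diag_def complex_eq_iff)
  qed
  then have "mat_diag n ((!) es) = real_diag n (\<lambda>i. Re (es ! i))"
    by (intro mat_diag_cong) (simp add: complex_eq_iff)
  with U AU e show ?thesis by auto
qed

lemma psd_matE:
  assumes "psd_mat n A"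
  obtains U f where "unitary_mat n U" "A = U * real_diag n f * mat_adjoint U" "\<And>i. i < n \<Longrightarrow> 0 \<le> f i"
proof -
  have "A \<in> carrier_mat n n" using assms unfolding psd_mat_def by simp
  from char_poly_factorized[OF this] obtain es where "char_poly A = (\<Prod>e\<leftarrow>es. [:- e, 1:])" by blast
  from psd_mat_diagonalization[OF assms this] obtain U where "unitary_mat n U"
    and "A = U * real_diag n (\<lambda>i. Re (es ! i)) * mat_adjoint U" and "\<forall>i<n. 0 \<le> Re (es ! i)"
    by auto
  then show thesis by (intro that[of U "\<lambda>i. Re (es ! i)"]) simp_all
qed

section \<open>Square roots and their traces\<close>

text \<open>This evaluates the definite description in \<open>mat_sqrt\<close>. Entrywise roots in
  the eigenbasis give existence; for uniqueness, another root \<open>B\<close> is diagonalized and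
  its eigenbasis compared with \<open>U\<close>.\<close>

lemma mat_sqrt_real_diag:
  assumes U: "unitary_mat n U" and f: "\<And>i. i < n \<Longrightarrow> 0 \<le> f i"
  shows "mat_sqrt (U * real_diag n f * mat_adjoint U) =
    U * real_diag n (\<lambda>i. sqrt (f i)) * mat_adjoint U"
proof -
  let ?A = "U * real_diag n f * mat_adjoint U"
  let ?S = "U * real_diag n (\<lambda>i. sqrt (f i)) * mat_adjoint U"
  note Uc = unitary_matD[OF U]
  note [simp] = assoc_mult_mat[of _ n n _ n _ n] unitary_mat_cancel[OF U] Uc mult_carrier_mat[of _ n n _ n]
  have dim: "dim_row ?A = n" using carrier_matD(1)[OF Uc(1)] by simp
  have S_psd: "psd_mat n ?S" using U f by (intro psd_mat_real_diag) auto
  have S_sq: "?S * ?S = ?A"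
  proof -
    have "?S * ?S = U * (real_diag n (\<lambda>i. sqrt (f i)) * real_diag n (\<lambda>i. sqrt (f i))) * mat_adjoint U"
      by (simp del: mat_diag_diag)
    also have "real_diag n (\<lambda>i. sqrt (f i)) * real_diag n (\<lambda>i. sqrt (f i)) = real_diag n f"
      using f by (simp flip: of_real_mult cong: mat_diag_cong)
    finally show ?thesis .
  qed
  have unique: "B = ?S" if B: "psd_mat n B" and BB: "B * B = ?A" for B
  proof -
    obtain V g where V: "unitary_mat n V" and BV: "B = V * real_diag n g * mat_adjoint V"
      and g: "\<And>i. i < n \<Longrightarrow> 0 \<le> g i" using psd_matE[OF B] by blast
    note Vc = unitary_matD[OF V]
    note [simp] = unitary_mat_cancel[OF V] Vc
    \<comment> \<open>The entry \<open>T\<^sub>i\<^sub>j\<close> vanishes unless \<open>g\<^sub>i\<^sup>2 = f\<^sub>j\<close>, that is, unless \<open>g\<^sub>i = sqrt f\<^sub>j\<close>.\<close>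
    define T where "T = mat_adjoint V * U"
    have T: "T \<in> carrier_mat n n" unfolding T_def by simp
    have "real_diag n (\<lambda>i. g i * g i) * T = mat_adjoint V * (B * B) * U"
      unfolding BV T_def by (simp flip: assoc_mult_mat[of "mat_diag n _" n n "mat_diag n _" n _ n])
    also have "\<dots> = T * real_diag n f" unfolding BB T_def by (simp add: right_mult_one_mat[of _ n n])
    finally have "mat n n (\<lambda>(i, j). complex_of_real (g i * g i) * T $$ (i, j)) =
      mat n n (\<lambda>(i, j). T $$ (i, j) * complex_of_real (f j))"
      using T by (simp add: mat_diag_mult_left[of _ n n] mat_diag_mult_right[of _ n n])
    then have sq: "complex_of_real (g i * g i) * T $$ (i, j) = T $$ (i, j) * complex_of_real (f j)"
      if "i < n" "j < n" for i j
      using that by (auto dest!: arg_cong[where f = "\<lambda>M. M $$ (i, j)"])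
    have "complex_of_real (g i) * T $$ (i, j) = T $$ (i, j) * complex_of_real (sqrt (f j))"
      if ij: "i < n" "j < n" for i j
    proof (cases "T $$ (i, j) = 0")
      case False
      then have "complex_of_real (g i * g i) = complex_of_real (f j)" using sq[OF ij] by simp
      then have "f j = g i * g i" by (simp only: of_real_eq_iff)
      then have "g i = sqrt (f j)" using g[OF ij(1)] by simp
      then show ?thesis by simp
    qed simp
    \<comment> \<open>\<open>T\<close> intertwines the two diagonal roots; undoing both changes of
      basis identifies \<open>B\<close> with the candidate.\<close>
    then have "real_diag n g * T = T * real_diag n (\<lambda>i. sqrt (f i))"
      using T by (auto simp: mat_diag_mult_left[of _ n n] mat_diag_mult_right[of _ n n] intro!: eq_matI)
    then have "V * (real_diag n g * T) * mat_adjoint U = V * (T * real_diag n (\<lambda>i. sqrt (f i))) * mat_adjoint U"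
      by simp
    then show ?thesis unfolding BV T_def by (simp add: right_mult_one_mat[of _ n n])
  qed
  show ?thesis
    unfolding mat_sqrt_def dim
  proof (rule the_equality)
    show "psd_mat n ?S \<and> ?S * ?S = ?A" using S_psd S_sq by (rule conjI)
    show "B = ?S" if "psd_mat n B \<and> B * B = ?A" for B
      using that by (elim conjE) (rule unique)
  qed
qed

lemma mat_trace_unitary_conj:
  assumes "unitary_mat n U" "X \<in> carrier_mat n n"
  shows "mat_trace (U * X * mat_adjoint U) = mat_trace X"
proof -
  note Uc = unitary_matD[OF assms(1)]
  have "mat_trace (U * X * mat_adjoint U) = mat_trace (mat_adjoint U * (U * X))"
    using Uc assms(2) by (intro mat_trace_comm[of _ n n]) (simp_all add: mult_carrier_mat[of _ n n _ n])
  also have "mat_adjoint U * (U * X) = X" using unitary_mat_cancel[OF assms] by simp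
  finally show ?thesis .
qed

text \<open>Needed so that the outer root cancels the square in \<open>fidelity\<close>.\<close>

lemma mat_trace_mat_sqrt_nonneg:
  assumes "psd_mat n A"
  shows "0 \<le> Re (mat_trace (mat_sqrt A))"
proof -
  obtain U f where "unitary_mat n U" "A = U * real_diag n f * mat_adjoint U" "\<And>i. i < n \<Longrightarrow> 0 \<le> f i"
    using psd_matE[OF assms] by blast
  then show ?thesis by (auto simp: mat_sqrt_real_diag mat_trace_unitary_conj intro!: sum_nonneg)
qed

text \<open>The quadratic form at \<open>v\<close> is the squared norm of
  \<open>M *\<^sub>v v\<close>.\<close>

lemma psd_mat_adjoint_mult_self:
  assumes M: "M \<in> carrier_mat n n"
  shows "psd_mat n (mat_adjoint M * M)"
  unfolding psd_mat_def
proof (intro conjI ballI)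
  fix v :: "complex vec" assume v: "v \<in> carrier_vec n"
  have Mv: "M *\<^sub>v v \<in> carrier_vec n" using M v by auto
  have "((mat_adjoint M * M) *\<^sub>v v) \<bullet>c v = (M *\<^sub>v v) \<bullet>c (M *\<^sub>v v)"
    using M v Mv by (simp add: assoc_mult_mat_vec[of _ n n _ n] mult_mat_vec_cscalar_prod[of _ n n])
  moreover have "0 \<le> (M *\<^sub>v v) \<bullet>c (M *\<^sub>v v)" by (rule conjugate_square_ge_0_vec)
  ultimately show "0 \<le> Re (((mat_adjoint M * M) *\<^sub>v v) \<bullet>c v)" by (simp add: less_eq_complex_def)
qed (use M in \<open>simp_all add: mat_adjoint_mult[of _ n n _ n] mult_carrier_mat[of _ n n _ n]\<close>)

section \<open>Partial isometries\<close>

text \<open>Equational form of being isometric on the orthogonal complement of the kernel; it passes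
  to the adjoint at once and makes \<open>X * mat_adjoint X\<close> a projection.\<close>

definition partial_isometry :: "nat \<Rightarrow> complex mat \<Rightarrow> bool" where
  "partial_isometry n X \<longleftrightarrow> X \<in> carrier_mat n n \<and> X * mat_adjoint X * X = X"

lemma unitary_mat_partial_isometry: "unitary_mat n U \<Longrightarrow> partial_isometry n U"
  using unitary_matD[of n U] unfolding partial_isometry_def by auto

lemma partial_isometry_adjoint:
  assumes "partial_isometry n X"
  shows "partial_isometry n (mat_adjoint X)"
proof -
  have X: "X \<in> carrier_mat n n" "X * mat_adjoint X * X = X"
    using assms unfolding partial_isometry_def by auto
  from arg_cong[OF X(2), of mat_adjoint] X(1) show ?thesis
    unfolding partial_isometry_def
    by (simp add: mat_adjoint_mult[of _ n n _ n] mult_carrier_mat[of _ n n _ n] assoc_mult_mat[of _ n n _ n _ n])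
qed

lemma partial_isometry_unitary_mult:
  assumes X: "partial_isometry n X" and U: "unitary_mat n U" and V: "unitary_mat n V"
  shows "partial_isometry n (U * X * V)"
proof -
  have Xc: "X \<in> carrier_mat n n" and XXX: "X * mat_adjoint X * X = X"
    using X unfolding partial_isometry_def by auto
  note Uc = unitary_matD[OF U] and Vc = unitary_matD[OF V]
  note [simp] = assoc_mult_mat[of _ n n _ n _ n] unitary_mat_cancel[OF U] unitary_mat_cancel[OF V]
    Uc Vc Xc mult_carrier_mat[of _ n n _ n] mat_adjoint_mult[of _ n n _ n]
  have "(U * X * V) * mat_adjoint (U * X * V) * (U * X * V) = U * (X * mat_adjoint X * X) * V"
    by simp
  then show ?thesis unfolding partial_isometry_def XXX by simp
qed

lemma partial_isometry_row_le:
  assumes X: "partial_isometry n X" and i: "i < n"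
  shows "(\<Sum>j<n. (cmod (X $$ (i, j)))\<^sup>2) \<le> 1"
proof -
  have Xc: "X \<in> carrier_mat n n" and XXX: "X * mat_adjoint X * X = X"
    using X unfolding partial_isometry_def by auto
  \<comment> \<open>\<open>G\<close> is an orthogonal projection, so its diagonal entries satisfy \<open>s\<^sup>2 \<le> s\<close>.\<close>
  define G where "G = X * mat_adjoint X"
  define s where "s = (\<Sum>j<n. (cmod (X $$ (i, j)))\<^sup>2)"
  have G: "G \<in> carrier_mat n n" unfolding G_def using Xc by (simp_all add: mult_carrier_mat[of _ n n _ n])
  have "G * G = (X * mat_adjoint X * X) * mat_adjoint X"
    unfolding G_def using Xc by (simp add: mult_carrier_mat[of _ n n _ n] assoc_mult_mat[of _ n n _ n _ n])
  then have idem: "G * G = G" unfolding XXX G_def .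
  have herm: "mat_adjoint G = G" unfolding G_def using Xc by (simp add: mat_adjoint_mult[of _ n n _ n])
  have Gii: "G $$ (i, i) = complex_of_real s"
    unfolding G_def s_def of_real_sum mult_cnj_cmod[symmetric]
    using Xc i by (simp add: scalar_prod_def atLeast0LessThan cong: sum.cong_simp)
  \<comment> \<open>As \<open>G\<close> equals \<open>G * mat_adjoint G\<close>, its diagonal entry
    \<open>s\<close> is the squared norm of row \<open>i\<close>, to which the term
    \<open>k = i\<close> alone contributes \<open>s\<^sup>2\<close>.\<close>
  have "complex_of_real s = (G * mat_adjoint G) $$ (i, i)" using idem herm Gii by simp
  also have "\<dots> = complex_of_real (\<Sum>k<n. (cmod (G $$ (i, k)))\<^sup>2)"
    unfolding of_real_sum mult_cnj_cmod[symmetric]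
    using G i by (simp add: scalar_prod_def atLeast0LessThan cong: sum.cong_simp)
  finally have "s = (\<Sum>k<n. (cmod (G $$ (i, k)))\<^sup>2)" by (simp only: of_real_eq_iff)
  moreover have "(cmod (G $$ (i, i)))\<^sup>2 \<le> (\<Sum>k<n. (cmod (G $$ (i, k)))\<^sup>2)"
    using i by (intro member_le_sum) auto
  moreover have "(cmod (G $$ (i, i)))\<^sup>2 = s\<^sup>2" unfolding Gii by simp
  ultimately have "s\<^sup>2 \<le> s" by simp
  have "s \<le> 1"
  proof (rule ccontr)
    assume "\<not> s \<le> 1"
    then have "s * 1 < s * s" by (intro mult_strict_left_mono) auto
    with \<open>s\<^sup>2 \<le> s\<close> show False by (simp add: power2_eq_square)
  qed
  then show ?thesis unfolding s_def .
qed

lemma partial_isometry_col_le: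
  assumes X: "partial_isometry n X" and j: "j < n"
  shows "(\<Sum>i<n. (cmod (X $$ (i, j)))\<^sup>2) \<le> 1"
  using partial_isometry_row_le[OF partial_isometry_adjoint[OF X] j] X j
  unfolding partial_isometry_def by (auto cong: sum.cong_simp)

section \<open>Polar decomposition and the trace bound\<close>

text \<open>\<open>K\<close> is the pseudo-inverse of the modulus of \<open>M\<close> times
  \<open>mat_adjoint M\<close>, so \<open>K * M\<close> is that pseudo-inverse times the squared
  modulus, which is the modulus again.\<close>

lemma ex_polar_partial_isometry:
  assumes M: "M \<in> carrier_mat n n"
  shows "\<exists>K. partial_isometry n K \<and> K * M = mat_sqrt (mat_adjoint M * M)"
proof -
  obtain C f where C: "unitary_mat n C" and MM: "mat_adjoint M * M = C * real_diag n f * mat_adjoint C"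
    and f: "\<And>i. i < n \<Longrightarrow> 0 \<le> f i"
    using psd_matE[OF psd_mat_adjoint_mult_self[OF M]] by blast
  note Cc = unitary_matD[OF C]
  \<comment> \<open>Division by zero gives \<open>s i = 0\<close> where \<open>f i = 0\<close>: \<open>s\<close> is the pseudo-inverse, which is what makes
    \<open>K\<close> a partial isometry also for singular \<open>M\<close>.\<close>
  define s where "s i = 1 / sqrt (f i)" for i
  define K where "K = C * real_diag n s * mat_adjoint C * mat_adjoint M"
  note [simp] = assoc_mult_mat[of _ n n _ n _ n] unitary_mat_cancel[OF C] M
    Cc mult_carrier_mat[of _ n n _ n] mat_adjoint_mult[of _ n n _ n]
  have diag_mult: "mat_diag n g * (mat_diag n h * X) = mat_diag n (\<lambda>i. g i * h i) * X"
    if "X \<in> carrier_mat n n" for g h :: "nat \<Rightarrow> complex" and X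
    using that by (simp flip: assoc_mult_mat[of "mat_diag n _" n n "mat_diag n _" n _ n])
  have "K * M = C * real_diag n s * mat_adjoint C * (mat_adjoint M * M)"
    unfolding K_def by simp
  also have "\<dots> = C * real_diag n (\<lambda>i. s i * f i) * mat_adjoint C"
    unfolding MM by (simp add: diag_mult)
  also have "real_diag n (\<lambda>i. s i * f i) = real_diag n (\<lambda>i. sqrt (f i))"
    using f by (intro mat_diag_cong) (simp add: s_def real_div_sqrt)
  also have "C * \<dots> * mat_adjoint C = mat_sqrt (mat_adjoint M * M)"
    unfolding MM using mat_sqrt_real_diag[OF C f] by simp
  finally have KM: "K * M = mat_sqrt (mat_adjoint M * M)" .
  \<comment> \<open>Regrouping exposes \<open>mat_adjoint M * M\<close>, so that everything to the
    left of the last \<open>mat_adjoint M\<close> is diagonal in the basis \<open>C\<close>.\<close>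
  have "K * mat_adjoint K * K =
      C * real_diag n s * mat_adjoint C * (mat_adjoint M * M) *
      (C * real_diag n s * (real_diag n s * mat_adjoint C * mat_adjoint M))"
    unfolding K_def by simp
  also have "\<dots> = C * real_diag n (\<lambda>i. s i * (f i * (s i * s i))) * mat_adjoint C * mat_adjoint M"
    unfolding MM by (simp add: diag_mult mult.assoc)
  also have "real_diag n (\<lambda>i. s i * (f i * (s i * s i))) = real_diag n s"
    using f by (intro mat_diag_cong) (auto simp: s_def)
  finally have "K * mat_adjoint K * K = K" unfolding K_def .
  moreover have "K \<in> carrier_mat n n" unfolding K_def by simp
  ultimately show ?thesis using KM unfolding partial_isometry_def by blast
qed

text \<open>A variant of von Neumann's trace inequality, obtained entrywise by writing the trace as
  a bilinear form in \<open>a\<close> and \<open>b\<close>.\<close>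

lemma mat_trace_partial_isometries_le:
  assumes X: "partial_isometry n X" and Y: "partial_isometry n Y"
    and a: "\<And>i. i < n \<Longrightarrow> 0 \<le> a i" "\<And>i j. i \<le> j \<Longrightarrow> j < n \<Longrightarrow> a i \<le> a j"
    and b: "\<And>i. i < n \<Longrightarrow> 0 \<le> b i" "\<And>i j. i \<le> j \<Longrightarrow> j < n \<Longrightarrow> b i \<le> b j"
  shows "Re (mat_trace ((X * real_diag n b) * (Y * real_diag n a))) \<le> (\<Sum>i<n. a i * b i)"
proof -
  have Xc: "X \<in> carrier_mat n n" and Yc: "Y \<in> carrier_mat n n"
    using X Y unfolding partial_isometry_def by auto
  \<comment> \<open>Each row sum of \<open>d\<close> averages a row of \<open>X\<close> with a
    column of \<open>Y\<close>, and each column sum a column of \<open>X\<close> with a row of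
    \<open>Y\<close>; hence all are at most 1.\<close>
  define d where "d i j = ((cmod (X $$ (i, j)))\<^sup>2 + (cmod (Y $$ (j, i)))\<^sup>2) / 2" for i j
  have "mat_trace ((X * real_diag n b) * (Y * real_diag n a)) =
    (\<Sum>i<n. \<Sum>j<n. (X $$ (i, j) * Y $$ (j, i)) * complex_of_real (a i * b j))"
    using Xc Yc
    by (simp add: mat_trace_def mat_diag_mult_right[of _ n n] scalar_prod_def atLeast0LessThan mult_ac
      cong: sum.cong_simp)
  then have "Re (mat_trace ((X * real_diag n b) * (Y * real_diag n a))) =
    (\<Sum>i<n. \<Sum>j<n. Re (X $$ (i, j) * Y $$ (j, i)) * (a i * b j))"
    by (simp only: Re_sum Re_complex_of_real times_complex.sel Im_complex_of_real mult_zero_right diff_zero)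
  also have "\<dots> \<le> (\<Sum>i<n. \<Sum>j<n. d i j * (a i * b j))"
  proof (intro sum_mono mult_right_mono)
    fix i j
    have "Re (X $$ (i, j) * Y $$ (j, i)) \<le> cmod (X $$ (i, j)) * cmod (Y $$ (j, i))"
      using complex_Re_le_cmod[of "X $$ (i, j) * Y $$ (j, i)"] by (simp add: norm_mult)
    also have "\<dots> \<le> d i j"
      using sum_squares_bound[of "cmod (X $$ (i, j))" "cmod (Y $$ (j, i))"] by (simp add: d_def)
    finally show "Re (X $$ (i, j) * Y $$ (j, i)) \<le> d i j" .
  qed (use a b in auto)
  also have "\<dots> \<le> (\<Sum>i<n. a i * b i)"
  proof (rule substochastic_bilinear_le)
    show "(\<Sum>j<n. d i j) \<le> 1" if "i < n" for i
      using partial_isometry_row_le[OF X that] partial_isometry_col_le[OF Y that]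
      by (simp add: d_def sum.distrib flip: sum_divide_distrib)
    show "(\<Sum>i<n. d i j) \<le> 1" if "j < n" for j
      using partial_isometry_col_le[OF X that] partial_isometry_row_le[OF Y that]
      by (simp add: d_def sum.distrib flip: sum_divide_distrib)
  qed (use a b in \<open>auto simp: d_def\<close>)
  finally show ?thesis .
qed

section \<open>Fidelity and the Bures angle\<close>

text \<open>The upper bound becomes a lower bound on the angle; non-negativity keeps the argument
  where \<open>arccos\<close> is decreasing.\<close>

lemma sqrt_fidelity_le:
  assumes U: "unitary_mat n U" and V: "unitary_mat n V"
    and p: "\<And>i. i < n \<Longrightarrow> 0 \<le> p i" "\<And>i j. i \<le> j \<Longrightarrow> j < n \<Longrightarrow> p i \<le> p j"
    and q: "\<And>i. i < n \<Longrightarrow> 0 \<le> q i" "\<And>i j. i \<le> j \<Longrightarrow> j < n \<Longrightarrow> q i \<le> q j"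
    and \<rho>: "\<rho> = U * real_diag n p * mat_adjoint U"
    and \<sigma>: "\<sigma> = V * real_diag n q * mat_adjoint V"
  shows "0 \<le> sqrt (fidelity \<rho> \<sigma>)" "sqrt (fidelity \<rho> \<sigma>) \<le> (\<Sum>i<n. sqrt (p i * q i))"
proof -
  note Uc = unitary_matD[OF U] and Vc = unitary_matD[OF V]
  define a b where "a i = sqrt (p i)" and "b i = sqrt (q i)" for i
  define R S where "R = U * real_diag n a * mat_adjoint U" and "S = V * real_diag n b * mat_adjoint V"
  note [simp] = assoc_mult_mat[of _ n n _ n _ n] unitary_mat_cancel[OF U] unitary_mat_cancel[OF V]
    Uc Vc mult_carrier_mat[of _ n n _ n] mat_adjoint_mult[of _ n n _ n]
  have R: "R \<in> carrier_mat n n" and S: "S \<in> carrier_mat n n" unfolding R_def S_def by simp_all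
  have adj: "mat_adjoint R = R" "mat_adjoint S = S" unfolding R_def S_def by simp_all
  have sqrt_\<rho>: "mat_sqrt \<rho> = R"
    unfolding \<rho> R_def a_def using mat_sqrt_real_diag[OF U p(1)] .
  have SS: "S * S = \<sigma>"
  proof -
    have "S * S = V * (real_diag n b * real_diag n b) * mat_adjoint V"
      unfolding S_def by (simp del: mat_diag_diag)
    also have "real_diag n b * real_diag n b = real_diag n q"
      using q(1) by (auto simp: b_def simp flip: of_real_mult intro!: mat_diag_cong)
    finally show ?thesis unfolding \<sigma> .
  qed
  \<comment> \<open>Splitting \<open>\<sigma>\<close> as \<open>S * S\<close> exhibits a Gram
    matrix, so the root of the fidelity is the trace of the modulus of \<open>S * R\<close>.\<close>
  have M: "mat_sqrt \<rho> * \<sigma> * mat_sqrt \<rho> = mat_adjoint (S * R) * (S * R)"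
    unfolding sqrt_\<rho> SS[symmetric] using R S by (simp add: adj)
  obtain K where K: "partial_isometry n K" and KM: "K * (S * R) = mat_sqrt (mat_adjoint (S * R) * (S * R))"
    using ex_polar_partial_isometry[of "S * R" n] R S by auto
  have Kc: "K \<in> carrier_mat n n" using K unfolding partial_isometry_def by auto
  let ?t = "Re (mat_trace (mat_sqrt (mat_sqrt \<rho> * \<sigma> * mat_sqrt \<rho>)))"
  have "psd_mat n (mat_adjoint (S * R) * (S * R))"
    using R S by (intro psd_mat_adjoint_mult_self) simp
  from mat_trace_mat_sqrt_nonneg[OF this] have t: "sqrt (fidelity \<rho> \<sigma>) = ?t" "0 \<le> ?t"
    unfolding fidelity_def M by auto
  then show "0 \<le> sqrt (fidelity \<rho> \<sigma>)" by simp
  \<comment> \<open>\<open>X\<close> and \<open>Y\<close> absorb the changes of basis, leaving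
    \<open>K * (S * R)\<close> as a unitary conjugate of a product with only diagonal matrices
    between them.\<close>
  define X Y where "X = mat_adjoint U * K * V" and "Y = mat_adjoint V * U"
  have X: "partial_isometry n X"
    unfolding X_def by (rule partial_isometry_unitary_mult[OF K unitary_mat_adjoint[OF U] V])
  have Y: "partial_isometry n Y"
    unfolding Y_def
    by (rule unitary_mat_partial_isometry[OF unitary_mat_mult[OF unitary_mat_adjoint[OF V] U]])
  have "mat_sqrt (mat_sqrt \<rho> * \<sigma> * mat_sqrt \<rho>) = K * (S * R)"
    unfolding M by (rule KM[symmetric])
  also have "\<dots> =
      U * ((X * real_diag n b) * (Y * real_diag n a)) * mat_adjoint U"
    unfolding R_def S_def X_def Y_def using Kc by simp
  also have "mat_trace \<dots> = mat_trace ((X * real_diag n b) * (Y * real_diag n a))"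
    using X Y by (intro mat_trace_unitary_conj[OF U]) (simp add: partial_isometry_def)
  finally have "?t \<le> (\<Sum>i<n. a i * b i)"
    using X Y p q by (auto simp: a_def b_def intro!: mat_trace_partial_isometries_le)
  then show "sqrt (fidelity \<rho> \<sigma>) \<le> (\<Sum>i<n. sqrt (p i * q i))"
    unfolding t by (simp add: a_def b_def real_sqrt_mult)
qed

text \<open>In a common eigenbasis, products and roots act on the eigenvalues one by one. This gives
  the value at the minimizing unitary.\<close>

lemma sqrt_fidelity_commuting:
  assumes V: "unitary_mat n V"
    and p: "\<And>i. i < n \<Longrightarrow> 0 \<le> p i" and q: "\<And>i. i < n \<Longrightarrow> 0 \<le> q i"
  shows "sqrt (fidelity (V * real_diag n p * mat_adjoint V) (V * real_diag n q * mat_adjoint V)) =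
    (\<Sum>i<n. sqrt (p i * q i))"
proof -
  note Vc = unitary_matD[OF V]
  note [simp] = assoc_mult_mat[of _ n n _ n _ n] unitary_mat_cancel[OF V]
    Vc mult_carrier_mat[of _ n n _ n]
  let ?S = "V * real_diag n (\<lambda>i. sqrt (p i)) * mat_adjoint V"
  have root_p: "mat_sqrt (V * real_diag n p * mat_adjoint V) = ?S"
    using V p by (rule mat_sqrt_real_diag)
  have "?S * (V * real_diag n q * mat_adjoint V) * ?S =
      V * (real_diag n (\<lambda>i. sqrt (p i)) * real_diag n q * real_diag n (\<lambda>i. sqrt (p i))) * mat_adjoint V"
    by (simp del: mat_diag_diag)
  also have "real_diag n (\<lambda>i. sqrt (p i)) * real_diag n q * real_diag n (\<lambda>i. sqrt (p i)) =
      real_diag n (\<lambda>i. p i * q i)"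
    using p by (auto simp: mult_ac simp flip: of_real_mult intro!: mat_diag_cong)
  finally have root: "mat_sqrt (?S * (V * real_diag n q * mat_adjoint V) * ?S) =
      V * real_diag n (\<lambda>i. sqrt (p i * q i)) * mat_adjoint V"
    using mat_sqrt_real_diag[OF V, of "\<lambda>i. p i * q i"] p q by simp
  have "fidelity (V * real_diag n p * mat_adjoint V) (V * real_diag n q * mat_adjoint V) =
      (\<Sum>i<n. sqrt (p i * q i))\<^sup>2"
    unfolding fidelity_def root_p root
    using mat_trace_unitary_conj[OF V, of "real_diag n (\<lambda>i. sqrt (p i * q i))"] by simp
  moreover have "0 \<le> (\<Sum>i<n. sqrt (p i * q i))" using p q by (intro sum_nonneg) simp
  ultimately show ?thesis by simp
qed

section \<open>Sorted spectra and the minimum over the unitary orbit\<close>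

text \<open>Sorting only permutes the linear factors of the characteristic polynomial, so an
  eigenbasis can be listed in the sorted order. The sum is the trace.\<close>

lemma density_mat_sorted_diagonalization:
  assumes A: "density_mat n A" and p: "eigenvalue_vector n A p"
  obtains U where "unitary_mat n U" "A = U * real_diag n ((!) (sort p)) * mat_adjoint U"
    "\<And>i. i < n \<Longrightarrow> 0 \<le> sort p ! i" "(\<Sum>i<n. sort p ! i) = 1"
proof -
  have psd: "psd_mat n A" and tr: "mat_trace A = 1" using A unfolding density_mat_def by auto
  have len: "length p = n" and char: "char_poly A = (\<Prod>a\<leftarrow>p. [:- complex_of_real a, 1:])"
    using p unfolding eigenvalue_vector_def by auto
  have "(\<Prod>a\<leftarrow>p. [:- complex_of_real a, 1:]) = (\<Prod>a\<leftarrow>sort p. [:- complex_of_real a, 1:])"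
    by (simp flip: prod_mset_prod_list)
  then have "char_poly A = (\<Prod>e\<leftarrow>map complex_of_real (sort p). [:- e, 1:])"
    unfolding char by (simp add: o_def)
  from psd_mat_diagonalization[OF psd this] obtain U where U: "unitary_mat n U"
    and "A = U * real_diag n (\<lambda>i. Re (map complex_of_real (sort p) ! i)) * mat_adjoint U"
    and pos: "\<forall>i<n. 0 \<le> Re (map complex_of_real (sort p) ! i)" by auto
  moreover have "real_diag n (\<lambda>i. Re (map complex_of_real (sort p) ! i)) = real_diag n ((!) (sort p))"
    using len by (intro mat_diag_cong) simp
  ultimately have AU: "A = U * real_diag n ((!) (sort p)) * mat_adjoint U" by simp
  have "complex_of_real (\<Sum>i<n. sort p ! i) = 1"
    using tr mat_trace_unitary_conj[OF U, of "real_diag n ((!) (sort p))"] by (simp add: AU)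
  then have sum_eq: "(\<Sum>i<n. sort p ! i) = 1" by (simp only: of_real_eq_1_iff)
  have nonneg: "0 \<le> sort p ! i" if "i < n" for i using pos len that by simp
  show thesis using U AU nonneg sum_eq by (rule that)
qed

theorem mainTheorem5:
  fixes n :: nat and \<rho> \<sigma> :: "complex mat" and p q :: "real list"
  assumes "density_mat n \<rho>" and "density_mat n \<sigma>"
    and "eigenvalue_vector n \<rho> p" and "eigenvalue_vector n \<sigma> q"
  shows "(\<exists>U. unitary_mat n U \<and>
            bures_angle (U * \<rho> * mat_adjoint U) \<sigma> = min_bures_angle n \<rho> \<sigma>) \<and>
         (\<forall>U. unitary_mat n U \<longrightarrow>
            min_bures_angle n \<rho> \<sigma> \<le> bures_angle (U * \<rho> * mat_adjoint U) \<sigma>) \<and>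
         min_bures_angle n \<rho> \<sigma> = arccos (\<Sum>i<n. sqrt (sort p ! i * sort q ! i))"
proof -
  define P Q where "P = (!) (sort p)" and "Q = (!) (sort q)"
  obtain A where A: "unitary_mat n A" and \<rho>: "\<rho> = A * real_diag n P * mat_adjoint A"
    and P: "\<And>i. i < n \<Longrightarrow> 0 \<le> P i" "(\<Sum>i<n. P i) = 1"
    using density_mat_sorted_diagonalization[OF assms(1,3)] unfolding P_def by blast
  obtain B where B: "unitary_mat n B" and \<sigma>: "\<sigma> = B * real_diag n Q * mat_adjoint B"
    and Q: "\<And>i. i < n \<Longrightarrow> 0 \<le> Q i" "(\<Sum>i<n. Q i) = 1"
    using density_mat_sorted_diagonalization[OF assms(2,4)] unfolding Q_def by blast
  have mono: "P i \<le> P j" "Q i \<le> Q j" if "i \<le> j" "j < n" for i j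
    using that assms(3,4) unfolding P_def Q_def eigenvalue_vector_def
    by (auto intro: sorted_nth_mono)
  note [simp] = assoc_mult_mat[of _ n n _ n _ n] mult_carrier_mat[of _ n n _ n]
    mat_adjoint_mult[of _ n n _ n] unitary_mat_cancel[OF A]
    unitary_matD(1)[OF A] unitary_matD(1)[OF B]
  let ?s = "\<Sum>i<n. sqrt (P i * Q i)"
  \<comment> \<open>Monotonicity of \<open>arccos\<close> is only available on
    \<open>[-1, 1]\<close>. The bound is AM-GM in each term, as both spectra sum to 1.\<close>
  have s: "?s \<le> 1"
  proof -
    have "?s \<le> (\<Sum>i<n. (P i + Q i) / 2)"
      using P Q by (intro sum_mono arith_geo_mean_sqrt) auto
    also have "\<dots> = 1" using P Q by (simp add: sum.distrib flip: sum_divide_distrib)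
    finally show ?thesis .
  qed
  define f where "f U = bures_angle (U * \<rho> * mat_adjoint U) \<sigma>" for U
  have lower: "arccos ?s \<le> f U" if U: "unitary_mat n U" for U
  proof -
    have "U * \<rho> * mat_adjoint U = (U * A) * real_diag n P * mat_adjoint (U * A)"
      using unitary_matD(1)[OF U] unfolding \<rho> by simp
    note bounds = sqrt_fidelity_le[OF unitary_mat_mult[OF U A] B P(1) mono(1) Q(1) mono(2) this \<sigma>]
    have "- 1 \<le> sqrt (fidelity (U * \<rho> * mat_adjoint U) \<sigma>)" using bounds(1) by linarith
    with bounds(2) s show ?thesis unfolding f_def bures_angle_def by (intro arccos_le_arccos) auto
  qed
  \<comment> \<open>\<open>W\<close> carries the eigenbasis of \<open>\<rho>\<close> to that of
    \<open>\<sigma>\<close>, pairing eigenvalues of equal rank.\<close>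
  define W where "W = B * mat_adjoint A"
  have W: "unitary_mat n W"
    unfolding W_def by (intro unitary_mat_mult B unitary_mat_adjoint A)
  have "W * \<rho> * mat_adjoint W = B * real_diag n P * mat_adjoint B"
    unfolding W_def \<rho> by simp
  then have attained: "f W = arccos ?s"
    unfolding f_def bures_angle_def \<sigma> using sqrt_fidelity_commuting[OF B P(1) Q(1)] by simp
  \<comment> \<open>\<open>LEAST\<close> over the reals is determined here because the lower bound
    is attained at \<open>W\<close>.\<close>
  have "min_bures_angle n \<rho> \<sigma> = arccos ?s"
    unfolding min_bures_angle_def f_def[symmetric]
    by (rule Least_equality) (use W attained lower in force)+
  with W attained lower show ?thesis unfolding f_def P_def Q_def by auto
qed

end
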